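(* If $G$ is a finite simple bipartite graph with a perfect matching, then $f(G)\geq \delta(G)-1$. Moreover, the bound is tight: for all integers $0\le k\le n-1$ the bipartite graph $H_{n,k}$ satisfies $f(H_{n,k})=\delta(H_{n,k})-1$.
   Context: For a graph $G$ with a perfect matching $M$, a subset $S\subseteq M$ is a forcing set of $M$ if $S$ is contained in no perfect matching of $G$ other than $M$. $f(G,M)$ is the minimum size of a forcing set of $M$, and $f(G)=\min_M f(G,M)$ over all perfect matchings $M$. $\delta(G)$ is the minimum degree. $H_{n,k}$ is the bipartite graph with parts $\{u_1,\dots,u_n\}$ and $\{v_1,\dots,v_n\}$ in which $u_iv_j$ is a non-edge if and only if $1\leq i<j\leq n-k$. *)

theory Defs
  imports Main
begin

record 'a ugraph =
  verts :: "'a set"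
  edges :: "'a set set"

definition finite_simple_graph :: "'a ugraph \<Rightarrow> bool" where
  "finite_simple_graph G \<longleftrightarrow>
     finite (verts G) \<and> (\<forall>e\<in>edges G. e \<subseteq> verts G \<and> card e = 2)"

definition bipartite :: "'a ugraph \<Rightarrow> bool" where
  "bipartite G \<longleftrightarrow>
     (\<exists>X Y. X \<union> Y = verts G \<and> X \<inter> Y = {} \<and>
            (\<forall>e\<in>edges G. \<exists>x\<in>X. \<exists>y\<in>Y. e = {x, y}))"

definition deg :: "'a ugraph \<Rightarrow> 'a \<Rightarrow> nat" where
  "deg G v = card {e \<in> edges G. v \<in> e}"

text \<open>The value 0 for the graph without vertices is a convention.\<close>

definition min_deg :: "'a ugraph \<Rightarrow> nat" where
  "min_deg G = (if verts G = {} then 0 else Min (deg G ` verts G))"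

definition perfect_matching :: "'a ugraph \<Rightarrow> 'a set set \<Rightarrow> bool" where
  "perfect_matching G M \<longleftrightarrow>
     M \<subseteq> edges G \<and> (\<forall>v\<in>verts G. \<exists>!e. e \<in> M \<and> v \<in> e)"

definition forcing_set :: "'a ugraph \<Rightarrow> 'a set set \<Rightarrow> 'a set set \<Rightarrow> bool" where
  "forcing_set G M S \<longleftrightarrow>
     S \<subseteq> M \<and> (\<forall>M'. perfect_matching G M' \<and> S \<subseteq> M' \<longrightarrow> M' = M)"

text \<open>
  The two minima below are meaningful for a finite graph \<open>G\<close> with a perfect matching \<open>M\<close>:
  \<open>M\<close> is then a forcing set of itself, so both minima are over nonempty finite sets.
\<close>

definition matching_forcing_number :: "'a ugraph \<Rightarrow> 'a set set \<Rightarrow> nat" where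
  "matching_forcing_number G M = Min (card ` {S. forcing_set G M S})"

definition forcing_number :: "'a ugraph \<Rightarrow> nat" where
  "forcing_number G = Min (matching_forcing_number G ` {M. perfect_matching G M})"

text \<open>\<open>Inl i\<close> and \<open>Inr j\<close> stand for the vertices \<open>u\<^sub>i\<close> and \<open>v\<^sub>j\<close>.\<close>

definition H_graph :: "nat \<Rightarrow> nat \<Rightarrow> (nat + nat) ugraph" where
  "H_graph n k =
     \<lparr> verts = Inl ` {1..n} \<union> Inr ` {1..n},
       edges = {{Inl i, Inr j} | i j.
                  i \<in> {1..n} \<and> j \<in> {1..n} \<and> \<not> (1 \<le> i \<and> i < j \<and> j \<le> n - k)} \<rparr>"

end

theory Submission imports Defs begin

text \<open>
  Let \<open>S\<close> be a forcing set of the perfect matching \<open>{{x, m x} | x \<in> X}\<close>. If every \<open>x\<close> missed by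
  \<open>S\<close> had a neighbour \<open>m (f x)\<close>, \<open>f x \<noteq> x\<close>, also missed by \<open>S\<close>, then \<open>f\<close> would permute some
  nonempty set of missed vertices, and rerouting the matching along that permutation would give a
  second perfect matching containing \<open>S\<close>. So some \<open>x\<close> has all its neighbours among \<open>m x\<close> and the
  endpoints of \<open>S\<close>, whence \<open>\<delta>(G) \<le> |S| + 1\<close>. In \<open>H\<^sub>n\<^sub>,\<^sub>k\<close> the edges \<open>u\<^sub>iv\<^sub>i\<close> with \<open>i > n - k\<close> force
  the diagonal matching, because the rest of the graph is lower triangular.
\<close>

section \<open>Forcing numbers as minima\<close>

lemma finite_simple_graph_finite_edges:
  assumes "finite_simple_graph G"
  shows "finite (edges G)"
proof -
  have "edges G \<subseteq> Pow (verts G)" "finite (verts G)"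
    using assms by (auto simp: finite_simple_graph_def)
  then show ?thesis by (meson finite_Pow_iff finite_subset)
qed

text \<open>Each edge of \<open>M'\<close> shares a vertex with some edge of \<open>M\<close>, which
  also lies in \<open>M'\<close>, so the two coincide. Hence \<open>M\<close> forces itself and the
  minima below range over nonempty sets.\<close>

lemma perfect_matching_maximal:
  assumes G: "finite_simple_graph G" and M: "perfect_matching G M"
    and M': "perfect_matching G M'" and sub: "M \<subseteq> M'"
  shows "M' = M"
proof
  show "M' \<subseteq> M"
  proof
    fix e assume e: "e \<in> M'"
    then have "e \<subseteq> verts G" "card e = 2"
      using G M' by (auto simp: finite_simple_graph_def perfect_matching_def)
    moreover from this have "e \<noteq> {}" by force
    ultimately obtain v where v: "v \<in> e" "v \<in> verts G" by blast
    then obtain d where d: "d \<in> M" "v \<in> d" using M unfolding perfect_matching_def by blast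
    then have "d = e" using e v M' sub unfolding perfect_matching_def by blast
    then show "e \<in> M" using d by simp
  qed
qed (use sub in simp)

lemma forcing_set_self:
  assumes "finite_simple_graph G" "perfect_matching G M"
  shows "forcing_set G M M"
  using perfect_matching_maximal[OF assms] by (auto simp: forcing_set_def)

lemma finite_perfect_matchings:
  assumes "finite_simple_graph G"
  shows "finite {M. perfect_matching G M}"
  by (rule finite_subset[of _ "Pow (edges G)"])
     (use finite_simple_graph_finite_edges[OF assms] in \<open>auto simp: perfect_matching_def\<close>)

lemma finite_forcing_sets:
  assumes "finite_simple_graph G" "perfect_matching G M"
  shows "finite {S. forcing_set G M S}"
  by (rule finite_subset[of _ "Pow (edges G)"])
     (use finite_simple_graph_finite_edges[OF assms(1)] assms(2) in
       \<open>auto simp: perfect_matching_def forcing_set_def\<close>)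

lemma forcing_number_le:
  assumes "finite_simple_graph G" "perfect_matching G M" "forcing_set G M S"
  shows "forcing_number G \<le> card S"
proof -
  have "forcing_number G \<le> matching_forcing_number G M"
    unfolding forcing_number_def
    by (rule Min_le) (use finite_perfect_matchings assms in auto)
  also have "\<dots> \<le> card S"
    unfolding matching_forcing_number_def
    by (rule Min_le) (use finite_forcing_sets assms in auto)
  finally show ?thesis .
qed

text \<open>Reduces a lower bound on the forcing number to a bound on the size of an arbitrary
  forcing set.\<close>

lemma forcing_number_attained:
  assumes G: "finite_simple_graph G" and ex: "\<exists>M. perfect_matching G M"
  obtains M S where "perfect_matching G M" "forcing_set G M S" "forcing_number G = card S"
proof -
  have "forcing_number G \<in> matching_forcing_number G ` {M. perfect_matching G M}"
    unfolding forcing_number_def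
    by (rule Min_in) (use finite_perfect_matchings[OF G] ex in auto)
  then obtain M where M: "perfect_matching G M" "forcing_number G = matching_forcing_number G M"
    by auto
  have "matching_forcing_number G M \<in> card ` {S. forcing_set G M S}"
    unfolding matching_forcing_number_def
    by (rule Min_in) (use finite_forcing_sets[OF G M(1)] forcing_set_self[OF G M(1)] in auto)
  then show ?thesis using M that by auto
qed

section \<open>Perfect matchings of bipartite graphs as bijections\<close>

text \<open>Names the parts that \<open>bipartite\<close> hides under its existential, so that a
  perfect matching can be treated as a map from \<open>X\<close> to \<open>Y\<close>.\<close>

definition bipartition :: "'a ugraph \<Rightarrow> 'a set \<Rightarrow> 'a set \<Rightarrow> bool" where
  "bipartition G X Y \<longleftrightarrow> X \<union> Y = verts G \<and> X \<inter> Y = {} \<and>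
     (\<forall>e\<in>edges G. \<exists>x\<in>X. \<exists>y\<in>Y. e = {x, y})"

lemma perfect_matching_of_bij:
  assumes b: "bipartition G X Y" and m: "bij_betw m X Y"
    and E: "\<And>x. x \<in> X \<Longrightarrow> {x, m x} \<in> edges G"
  shows "perfect_matching G ((\<lambda>x. {x, m x}) ` X)"
  unfolding perfect_matching_def
proof (intro conjI ballI)
  show "(\<lambda>x. {x, m x}) ` X \<subseteq> edges G" using E by auto
  fix v assume "v \<in> verts G"
  then consider "v \<in> X" | x where "x \<in> X" "v = m x"
    using b m by (auto simp: bipartition_def bij_betw_def)
  then show "\<exists>!e. e \<in> (\<lambda>x. {x, m x}) ` X \<and> v \<in> e"
  proof cases
    case 1
    then show ?thesis using b m
      by (intro ex1I[of _ "{v, m v}"]) (auto simp: bipartition_def bij_betw_def)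
  next
    case 2
    then show ?thesis using b m
      by (intro ex1I[of _ "{x, m x}"]) (auto simp: bipartition_def bij_betw_def inj_on_def)
  qed
qed

text \<open>Covering of \<open>X\<close> yields the map, covering of \<open>Y\<close> its
  surjectivity, and uniqueness of the edge at a vertex of \<open>Y\<close> its injectivity.\<close>

lemma bij_of_perfect_matching:
  assumes b: "bipartition G X Y" and M: "perfect_matching G M"
  obtains m where "bij_betw m X Y" "M = (\<lambda>x. {x, m x}) ` X"
proof -
  have edge: "\<exists>x\<in>X. \<exists>y\<in>Y. e = {x, y}" if "e \<in> M" for e
    using that b M by (auto simp: bipartition_def perfect_matching_def)
  have un: "d = e" if "d \<in> M" "e \<in> M" "v \<in> d" "v \<in> e" "v \<in> X \<union> Y" for d e v
    using that b M unfolding bipartition_def perfect_matching_def by metis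
  have cov: "\<exists>e\<in>M. v \<in> e" if "v \<in> X \<union> Y" for v
    using that b M unfolding bipartition_def perfect_matching_def by metis
  have disj: "X \<inter> Y = {}" using b by (simp add: bipartition_def)
  have "\<exists>y. y \<in> Y \<and> {x, y} \<in> M" if x: "x \<in> X" for x
  proof -
    obtain e where e: "e \<in> M" "x \<in> e" using cov x by blast
    then obtain x' y where "y \<in> Y" "e = {x', y}" using edge by blast
    then show ?thesis using e x disj by auto
  qed
  then obtain m where m: "\<And>x. x \<in> X \<Longrightarrow> m x \<in> Y \<and> {x, m x} \<in> M" by metis
  have eqM: "M = (\<lambda>x. {x, m x}) ` X"
  proof
    show "M \<subseteq> (\<lambda>x. {x, m x}) ` X"
    proof
      fix e assume e: "e \<in> M"
      then obtain x where "x \<in> X" "x \<in> e" using edge by blast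
      then have "e = {x, m x}" using un[of e "{x, m x}" x] e m by auto
      then show "e \<in> (\<lambda>x. {x, m x}) ` X" using \<open>x \<in> X\<close> by blast
    qed
  qed (use m in auto)
  have "inj_on m X"
  proof
    fix x x' assume x: "x \<in> X" "x' \<in> X" "m x = m x'"
    then have "{x, m x} \<in> M" "{x', m x'} \<in> M" "m x \<in> X \<union> Y" using m by blast+
    then have "{x, m x} = {x', m x'}" using x(3) by (intro un[of _ _ "m x"]) auto
    then show "x = x'" using x m disj by (auto simp: doubleton_eq_iff)
  qed
  moreover have "m ` X = Y"
  proof
    show "Y \<subseteq> m ` X"
    proof
      fix y assume y: "y \<in> Y"
      then obtain e where "e \<in> M" "y \<in> e" using cov by blast
      then obtain x where "x \<in> X" "y \<in> {x, m x}" using eqM by auto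
      then show "y \<in> m ` X" using y disj by auto
    qed
  qed (use m in auto)
  ultimately show ?thesis using that eqM by (auto simp: bij_betw_def)
qed

section \<open>The lower bound\<close>

text \<open>A nonempty invariant subset of least size works: its image is again nonempty and
  invariant, hence no smaller, so \<open>f\<close> is onto it and, by finiteness, injective on
  it.\<close>

lemma finite_self_map_bij_subset:
  assumes "finite A" "A \<noteq> {}" "f ` A \<subseteq> A"
  obtains C where "C \<subseteq> A" "C \<noteq> {}" "bij_betw f C C"
proof -
  let ?P = "\<lambda>C. C \<subseteq> A \<and> C \<noteq> {} \<and> f ` C \<subseteq> C"
  obtain C where C: "?P C" and min: "\<And>D. ?P D \<Longrightarrow> card C \<le> card D"
    using assms ex_has_least_nat[of ?P A card] by blast
  have "finite C" using C assms(1) finite_subset by blast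
  moreover have "card C \<le> card (f ` C)" using C by (intro min) auto
  ultimately have "f ` C = C" using C by (simp add: card_seteq)
  moreover then have "inj_on f C" using \<open>finite C\<close> by (simp add: eq_card_imp_inj_on)
  ultimately show ?thesis using that[of C] C by (simp add: bij_betw_def)
qed

text \<open>Otherwise the steps from \<open>x\<close> through \<open>m (f x)\<close> to
  \<open>f x\<close> close up into cycles alternating between edges outside \<open>M\<close> and
  edges of \<open>M\<close> not in \<open>S\<close>; switching along them gives another perfect
  matching containing \<open>S\<close>.\<close>

lemma forcing_set_confines_neighbours:
  assumes b: "bipartition G X Y" and fin: "finite X" and ne: "X \<noteq> {}"
    and m: "bij_betw m X Y" and M: "M = (\<lambda>x. {x, m x}) ` X" "M \<subseteq> edges G"
    and S: "forcing_set G M S"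
  shows "\<exists>x\<in>X. \<forall>z\<in>X. {x, m z} \<in> edges G \<longrightarrow> z = x \<or> {z, m z} \<in> S"
proof (rule ccontr)
  assume "\<not> ?thesis"
  then have "\<forall>x\<in>X. \<exists>z. z \<in> X \<and> {x, m z} \<in> edges G \<and> z \<noteq> x \<and> {z, m z} \<notin> S"
    by blast
  then obtain f where f: "\<And>x. x \<in> X \<Longrightarrow> f x \<in> X" "\<And>x. x \<in> X \<Longrightarrow> {x, m (f x)} \<in> edges G"
      "\<And>x. x \<in> X \<Longrightarrow> f x \<noteq> x" "\<And>x. x \<in> X \<Longrightarrow> {f x, m (f x)} \<notin> S"
    by metis
  define A where "A = {x\<in>X. {x, m x} \<notin> S}"
  \<comment> \<open>\<open>f\<close> sends all of \<open>X\<close> into \<open>A\<close>, so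
    \<open>A\<close> inherits nonemptiness from \<open>X\<close>.\<close>
  have "A \<noteq> {}" "finite A" "f ` A \<subseteq> A" using f ne fin by (auto simp: A_def)
  then obtain C where C: "C \<subseteq> A" "C \<noteq> {}" "bij_betw f C C"
    by (metis finite_self_map_bij_subset)
  \<comment> \<open>\<open>m \<circ> g\<close> keeps the partner of every vertex outside
    \<open>C\<close> and gives each \<open>x\<close> in \<open>C\<close> the old partner of
    \<open>f x\<close>.\<close>
  define g where "g = (\<lambda>x. if x \<in> C then f x else x)"
  have CX: "C \<subseteq> X" using C by (auto simp: A_def)
  have "bij_betw g C C" using C(3) by (simp add: g_def cong: bij_betw_cong)
  moreover have "bij_betw g (X - C) (X - C)" by (auto simp: g_def bij_betw_def inj_on_def)
  ultimately have "bij_betw g (C \<union> (X - C)) (C \<union> (X - C))"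
    by (intro bij_betw_combine) auto
  then have "bij_betw g X X" using CX by (simp add: Un_absorb1)
  then have mg: "bij_betw (m \<circ> g) X Y" using m bij_betw_trans by blast
  let ?M' = "(\<lambda>x. {x, (m \<circ> g) x}) ` X"
  have "perfect_matching G ?M'"
    by (rule perfect_matching_of_bij[OF b mg]) (use f M CX in \<open>auto simp: g_def\<close>)
  moreover have "S \<subseteq> ?M'"
  proof
    fix e assume "e \<in> S"
    moreover from this obtain x where x: "x \<in> X" "e = {x, m x}"
      using S M by (auto simp: forcing_set_def)
    ultimately have "x \<notin> C" using C(1) by (auto simp: A_def)
    then show "e \<in> ?M'" using x by (intro image_eqI[of _ _ x]) (auto simp: g_def)
  qed
  ultimately have "?M' = M" using S by (auto simp: forcing_set_def)
  \<comment> \<open>At a vertex \<open>c\<close> of \<open>C\<close> the two matchings differ: equal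
    partners would mean \<open>m (f c) = m c\<close>, hence \<open>f c = c\<close>. Since
    \<open>m\<close> takes no value in \<open>X\<close>, the doubletons cannot agree
    crosswise.\<close>
  obtain c where c: "c \<in> C" using C(2) by blast
  then have "{c, m (f c)} \<in> M" using \<open>?M' = M\<close> CX by (force simp: g_def)
  then obtain x where x: "x \<in> X" "{c, m (f c)} = {x, m x}" using M by auto
  have mX: "m z \<notin> X" if "z \<in> X" for z
    using that m b by (auto simp: bij_betw_def bipartition_def)
  have "c \<in> X" "f c \<in> X" using c CX f(1) by auto
  moreover from this have "m (f c) \<notin> X" "m x \<notin> X" using mX x(1) by blast+
  ultimately have "c = x" "m (f c) = m x" using x by (auto simp: doubleton_eq_iff)
  then have "f c = c" using m x(1) \<open>f c \<in> X\<close> by (auto simp: bij_betw_def inj_on_def)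
  then show False using f(3) \<open>c \<in> X\<close> by blast
qed

text \<open>Every edge at the confined vertex \<open>x\<close> ends in \<open>m x\<close> or in
  \<open>m z\<close> with \<open>{z, m z}\<close> in \<open>S\<close>, and distinct such
  \<open>z\<close> give distinct edges of \<open>S\<close>. So already the degree of
  \<open>x\<close> is at most \<open>card S + 1\<close>.\<close>

lemma min_deg_le_card_forcing_set:
  assumes G: "finite_simple_graph G" and bip: "bipartite G"
    and M: "perfect_matching G M" and S: "forcing_set G M S"
  shows "min_deg G \<le> card S + 1"
\<comment> \<open>Without vertices there is no \<open>x\<close> to choose, but
  \<open>min_deg\<close> is then 0 by convention.\<close>
proof (cases "verts G = {}")
  case False
  obtain X Y where b: "bipartition G X Y"
    using bip by (auto simp: bipartite_def bipartition_def)
  obtain m where m: "bij_betw m X Y" "M = (\<lambda>x. {x, m x}) ` X"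
    using bij_of_perfect_matching[OF b M] .
  have "M \<subseteq> edges G" using M by (simp add: perfect_matching_def)
  have finV: "finite (verts G)" using G by (simp add: finite_simple_graph_def)
  have fin: "finite X" using finV b by (metis bipartition_def finite_Un)
  have "X \<noteq> {}" using False b m by (auto simp: bipartition_def bij_betw_def)
  obtain x where x: "x \<in> X"
    "\<And>z. \<lbrakk>z \<in> X; {x, m z} \<in> edges G\<rbrakk> \<Longrightarrow> z = x \<or> {z, m z} \<in> S"
    using forcing_set_confines_neighbours[OF b fin \<open>X \<noteq> {}\<close> m \<open>M \<subseteq> edges G\<close> S] by blast
  define B where "B = {z\<in>X. {z, m z} \<in> S}"
  have finB: "finite B" using fin by (simp add: B_def)
  have "finite S"
    using S \<open>M \<subseteq> edges G\<close> finite_simple_graph_finite_edges[OF G]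
    by (meson finite_subset forcing_set_def)
  have "x = y" if "x \<in> X" "y \<in> X" "{x, m x} = {y, m y}" for x y
    using that b bij_betwE[OF m(1)] by (auto simp: bipartition_def doubleton_eq_iff)
  then have "inj_on (\<lambda>z. {z, m z}) B" by (auto intro!: inj_onI simp: B_def)
  then have "card B \<le> card S"
    using \<open>finite S\<close> by (intro card_inj_on_le) (auto simp: B_def)
  \<comment> \<open>As \<open>m\<close> is onto \<open>Y\<close>, the other end of an edge at
    \<open>x\<close> has the form \<open>m z\<close>, and the choice of \<open>x\<close> puts
    \<open>z\<close> in \<open>insert x B\<close>.\<close>
  have "{e \<in> edges G. x \<in> e} \<subseteq> (\<lambda>z. {x, m z}) ` insert x B"
  proof
    fix e assume e: "e \<in> {e \<in> edges G. x \<in> e}"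
    then obtain x' y where "x' \<in> X" "y \<in> Y" "e = {x', y}"
      using b by (auto simp: bipartition_def)
    moreover then have "x' = x" using e x(1) b by (auto simp: bipartition_def)
    moreover obtain z where "z \<in> X" "y = m z" using m \<open>y \<in> Y\<close> by (auto simp: bij_betw_def)
    ultimately show "e \<in> (\<lambda>z. {x, m z}) ` insert x B" using e x(2)[of z] by (auto simp: B_def)
  qed
  then have "deg G x \<le> card ((\<lambda>z. {x, m z}) ` insert x B)"
    unfolding deg_def using finB by (intro card_mono) auto
  also have "\<dots> \<le> card (insert x B)" using finB by (intro card_image_le) auto
  also have "\<dots> \<le> card B + 1" using finB by (simp add: card_insert_if)
  finally have "deg G x \<le> card S + 1" using \<open>card B \<le> card S\<close> by simp
  moreover have "x \<in> verts G" using x(1) b by (auto simp: bipartition_def)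
  then have "min_deg G \<le> deg G x" using False finV by (simp add: min_deg_def)
  ultimately show ?thesis by simp
qed (simp add: min_deg_def)

lemma min_deg_le_forcing_number:
  assumes "finite_simple_graph G" "bipartite G" "\<exists>M. perfect_matching G M"
  shows "min_deg G \<le> forcing_number G + 1"
  using forcing_number_attained[OF assms(1,3)] min_deg_le_card_forcing_set[OF assms(1,2)]
  by metis

section \<open>The extremal graphs\<close>

lemma H_graph_edge_iff:
  "{Inl i, Inr j} \<in> edges (H_graph n k) \<longleftrightarrow>
     i \<in> {1..n} \<and> j \<in> {1..n} \<and> \<not> (i < j \<and> j \<le> n - k)"
  by (auto simp: H_graph_def doubleton_eq_iff)

lemma finite_simple_graph_H_graph: "finite_simple_graph (H_graph n k)"
  by (auto simp: finite_simple_graph_def H_graph_def)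

lemma bipartition_H_graph: "bipartition (H_graph n k) (Inl ` {1..n}) (Inr ` {1..n})"
  unfolding bipartition_def
proof (intro conjI ballI)
  fix e assume "e \<in> edges (H_graph n k)"
  then obtain i j where "i \<in> {1..n}" "j \<in> {1..n}" "e = {Inl i, Inr j}"
    unfolding H_graph_def by auto
  then show "\<exists>x\<in>Inl ` {1..n}. \<exists>y\<in>Inr ` {1..n}. e = {x, y}" by blast
qed (auto simp: H_graph_def)

lemma bipartite_H_graph: "bipartite (H_graph n k)"
  using bipartition_H_graph unfolding bipartition_def bipartite_def by metis

lemma perfect_matching_H_graph:
  "perfect_matching (H_graph n k) ((\<lambda>i. {Inl i, Inr i}) ` {1..n})"
proof -
  let ?m = "Inr \<circ> projl :: nat + nat \<Rightarrow> nat + nat"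
  have "bij_betw ?m (Inl ` {1..n}) (Inr ` {1..n})"
    by (auto simp: bij_betw_def inj_on_def image_image)
  then have "perfect_matching (H_graph n k) ((\<lambda>x. {x, ?m x}) ` Inl ` {1..n})"
    by (rule perfect_matching_of_bij[OF bipartition_H_graph]) (auto simp: H_graph_edge_iff)
  then show ?thesis by (simp add: image_image)
qed

text \<open>If \<open>f i < i\<close>, induction gives \<open>f (f i) = f i\<close>, against
  injectivity. This is why a triangular bipartite graph has only the diagonal perfect
  matching.\<close>

lemma inj_on_decreasing_eq_id:
  fixes f :: "nat \<Rightarrow> nat"
  assumes "inj_on f {1..n}" "\<And>i. i \<in> {1..n} \<Longrightarrow> 1 \<le> f i \<and> f i \<le> i" "i \<in> {1..n}"
  shows "f i = i"
  using assms(3)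
proof (induction i rule: less_induct)
  case (less i)
  show ?case
  proof (rule ccontr)
    assume "f i \<noteq> i"
    then have lt: "f i < i" "f i \<in> {1..n}" using assms(2)[of i] less.prems by auto
    then have "f (f i) = f i" using less.IH by blast
    then show False using assms(1) lt less.prems by (auto dest: inj_onD)
  qed
qed

text \<open>A matching containing the prescribed edges is a permutation \<open>f\<close> of the
  indices with \<open>f i \<le> i\<close> throughout, hence the identity.\<close>

lemma forcing_set_H_graph:
  assumes "k < n"
  shows "forcing_set (H_graph n k) ((\<lambda>i. {Inl i, Inr i}) ` {1..n})
           ((\<lambda>i. {Inl i, Inr i}) ` {n - k <.. n})"
  unfolding forcing_set_def
proof (intro conjI allI impI)
  show "(\<lambda>i. {Inl i, Inr i}) ` {n - k <.. n} \<subseteq> (\<lambda>i. {Inl i, Inr i}) ` {1..n}"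
    using assms by (intro image_mono) auto
  fix M' :: "(nat + nat) set set"
  assume "perfect_matching (H_graph n k) M' \<and> (\<lambda>i. {Inl i, Inr i}) ` {n - k <.. n} \<subseteq> M'"
  then have M': "perfect_matching (H_graph n k) M'"
    and sub: "\<And>i. i \<in> {n - k <.. n} \<Longrightarrow> {Inl i, Inr i} \<in> M'" by auto
  obtain m where m: "bij_betw m (Inl ` {1..n}) (Inr ` {1..n})"
      "M' = (\<lambda>x. {x, m x}) ` (Inl ` {1..n})"
    using bij_of_perfect_matching[OF bipartition_H_graph M'] .
  define f where "f i = projr (m (Inl i))" for i :: nat
  have mf: "m (Inl i) = Inr (f i)" "f i \<in> {1..n}" if "i \<in> {1..n}" for i
  proof -
    have "m (Inl i) \<in> Inr ` {1..n}" using bij_betwE[OF m(1)] that by simp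
    then show "m (Inl i) = Inr (f i)" "f i \<in> {1..n}" unfolding f_def by auto
  qed
  have inj: "inj_on f {1..n}"
  proof
    fix i j assume "i \<in> {1..n}" "j \<in> {1..n}" "f i = f j"
    then have "m (Inl i) = m (Inl j)" using mf by simp
    then have "(Inl i :: nat + nat) = Inl j"
      using inj_onD[OF bij_betw_imp_inj_on[OF m(1)]] \<open>i \<in> {1..n}\<close> \<open>j \<in> {1..n}\<close> by blast
    then show "i = j" by simp
  qed
  have M'f: "M' = (\<lambda>i. {Inl i, Inr (f i)}) ` {1..n}"
    unfolding m(2) image_image by (intro image_cong) (use mf in auto)
  \<comment> \<open>Values up to \<open>n - k\<close> obey this because of the non-edges. A larger
    value is an index whose diagonal edge is prescribed, so \<open>f\<close> fixes it, and
    injectivity makes it equal to \<open>i\<close>.\<close>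
  have le: "f i \<le> i" if i: "i \<in> {1..n}" for i
  proof (cases "f i \<le> n - k")
    case True
    have "{Inl i, Inr (f i)} \<in> edges (H_graph n k)"
      using M' i unfolding M'f perfect_matching_def by blast
    then show ?thesis using True by (auto simp: H_graph_edge_iff)
  next
    case False
    then have "f i \<in> {n - k <.. n}" using mf(2)[OF i] by auto
    from sub[OF this] obtain l where "{Inl (f i), Inr (f i)} = {Inl l, Inr (f l) :: nat + nat}"
      unfolding M'f by blast
    then have "f (f i) = f i" by (simp add: doubleton_eq_iff)
    then have "f i = i" using inj_onD[OF inj] i mf(2)[OF i] by blast
    then show ?thesis by simp
  qed
  have "f i = i" if "i \<in> {1..n}" for i
    using inj_on_decreasing_eq_id[OF inj _ that] le mf(2) by auto
  then show "M' = (\<lambda>i. {Inl i, Inr i}) ` {1..n}"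
    unfolding M'f by (intro image_cong) auto
qed

lemma Suc_le_min_deg_H_graph:
  assumes "k < n"
  shows "k + 1 \<le> min_deg (H_graph n k)"
proof -
  let ?G = "H_graph n k"
  have finE: "finite {e \<in> edges ?G. v \<in> e}" for v
    using finite_simple_graph_finite_edges[OF finite_simple_graph_H_graph] by simp
  \<comment> \<open>These \<open>k + 1\<close> indices serve as neighbours on either side: all those
    above \<open>n - k\<close>, and one more, namely \<open>i\<close> itself if
    \<open>i \<le> n - k\<close> and otherwise \<open>n - k\<close>, which is at least 1 because
    \<open>k < n\<close>.\<close>
  define T where "T i = insert (min i (n - k)) {n - k <.. n}" for i
  have cardT: "card (T i) = k + 1" for i using assms by (simp add: T_def)
  have "k + 1 \<le> deg ?G (Inl i)" if "i \<in> {1..n}" for i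
  proof -
    have "card (T i) \<le> deg ?G (Inl i)" unfolding deg_def
      by (rule card_inj_on_le[where f = "\<lambda>j. {Inl i, Inr j}"])
         (use that assms finE in \<open>auto simp: inj_on_def doubleton_eq_iff H_graph_edge_iff T_def\<close>)
    then show ?thesis by (simp add: cardT)
  qed
  moreover have "k + 1 \<le> deg ?G (Inr j)" if "j \<in> {1..n}" for j
  proof -
    have "card (T j) \<le> deg ?G (Inr j)" unfolding deg_def
      by (rule card_inj_on_le[where f = "\<lambda>i. {Inl i, Inr j}"])
         (use that assms finE in \<open>auto simp: inj_on_def doubleton_eq_iff H_graph_edge_iff T_def\<close>)
    then show ?thesis by (simp add: cardT)
  qed
  moreover have "verts ?G = Inl ` {1..n} \<union> Inr ` {1..n}" by (simp add: H_graph_def)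
  ultimately show ?thesis using assms unfolding min_deg_def by auto
qed

lemma forcing_number_H_graph_le:
  assumes "k < n"
  shows "forcing_number (H_graph n k) \<le> k"
proof -
  have "forcing_number (H_graph n k) \<le> card ((\<lambda>i. {Inl i, Inr i} :: (nat + nat) set) ` {n - k <.. n})"
    using forcing_number_le finite_simple_graph_H_graph perfect_matching_H_graph
      forcing_set_H_graph[OF assms] by blast
  also have "\<dots> \<le> card {n - k <.. n}" by (rule card_image_le) simp
  also have "\<dots> = k" using assms by simp
  finally show ?thesis .
qed

theorem theorem2p6:
  "(\<forall>G :: 'a ugraph.
      finite_simple_graph G \<and> bipartite G \<and> (\<exists>M. perfect_matching G M) \<longrightarrow>
      int (forcing_number G) \<ge> int (min_deg G) - 1) \<and>
   (\<forall>n k :: nat. k < n \<longrightarrow>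
      finite_simple_graph (H_graph n k) \<and> bipartite (H_graph n k) \<and>
      (\<exists>M. perfect_matching (H_graph n k) M) \<and>
      int (forcing_number (H_graph n k)) = int (min_deg (H_graph n k)) - 1)"
proof (intro conjI allI impI)
  fix G :: "'a ugraph"
  assume "finite_simple_graph G \<and> bipartite G \<and> (\<exists>M. perfect_matching G M)"
  then have "min_deg G \<le> forcing_number G + 1" using min_deg_le_forcing_number by blast
  then show "int (forcing_number G) \<ge> int (min_deg G) - 1" by linarith
next
  fix n k :: nat
  assume kn: "k < n"
  show ex: "\<exists>M. perfect_matching (H_graph n k) M" using perfect_matching_H_graph by blast
  \<comment> \<open>With \<delta> the minimum degree and f the forcing number, the chain \<delta>
    \<le> f + 1 \<le> k + 1 \<le> \<delta> collapses to equalities, so a lower bound on the degrees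
    suffices.\<close>
  show "int (forcing_number (H_graph n k)) = int (min_deg (H_graph n k)) - 1"
    using min_deg_le_forcing_number[OF finite_simple_graph_H_graph bipartite_H_graph ex]
      forcing_number_H_graph_le[OF kn] Suc_le_min_deg_H_graph[OF kn] by linarith
qed (rule finite_simple_graph_H_graph bipartite_H_graph)+

end
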